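(* Let $n,D\ge 1$ be integers and let $\mu$ be a probability measure on $\mathbb{R}^n$ which is absolutely continuous with respect to the Lebesgue measure. For every $\epsilon>0$, any $(1-\epsilon)$-net of $(\mu,\mathrm{Poly}_+(n,2D))$ has size at least $\binom{n+D}{n}$.
   Context: $\mathrm{Poly}(n,d)$ is the real vector space of polynomials in $n$ variables with real coefficients of degree at most $d$, and $\mathrm{Poly}_+(n,d)=\{\{x\in\mathbb{R}^n : P(x)\ge 0\} : P\in \mathrm{Poly}(n,d)\}$ is the family of superlevel sets of such polynomials. For a family $F$ of subsets of $\mathbb{R}^n$, a probability measure $\mu$ on $\mathbb{R}^n$ and a real number $t$, a set $X\subset\mathbb{R}^n$ is a $t$-net for $(\mu,F)$ if for every $f\in F$ with $\mu(f)>t$ one has $f\cap X\ne\emptyset$. (No condition is imposed on the location of $X$.) The size of a net is its cardinality. *)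

theory Defs
  imports "HOL-Probability.Probability"
begin

text \<open>Multi-indices are functions \<open>'n \<Rightarrow> nat\<close>, where the number of variables is \<open>CARD('n)\<close>.\<close>

definition multiindices :: "nat \<Rightarrow> ('n::finite \<Rightarrow> nat) set" where
  "multiindices d = {\<alpha>. (\<Sum>i\<in>UNIV. \<alpha> i) \<le> d}"

lemma finite_multiindices: "finite (multiindices d :: ('n::finite \<Rightarrow> nat) set)"
proof (rule finite_subset)
  show "multiindices d \<subseteq> PiE (UNIV :: 'n set) (\<lambda>_. {..d})"
  proof
    fix \<alpha> :: "'n \<Rightarrow> nat" assume "\<alpha> \<in> multiindices d"
    then have "\<alpha> i \<le> d" for i
      using member_le_sum[of i UNIV \<alpha>] by (force simp: multiindices_def)
    then show "\<alpha> \<in> PiE UNIV (\<lambda>_. {..d})" by auto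
  qed
qed (simp add: finite_PiE)

definition monomial :: "('n::finite \<Rightarrow> nat) \<Rightarrow> real ^ 'n \<Rightarrow> real" where
  "monomial \<alpha> x = (\<Prod>i\<in>UNIV. (x $ i) ^ \<alpha> i)"

text \<open>Polynomials are identified with the functions they induce, which loses nothing since the
  coefficient field is infinite.\<close>

definition Poly :: "nat \<Rightarrow> (real ^ 'n::finite \<Rightarrow> real) set" where
  "Poly d = {P. \<exists>c. P = (\<lambda>x. \<Sum>\<alpha>\<in>multiindices d. c \<alpha> * monomial \<alpha> x)}"

definition Poly_plus :: "nat \<Rightarrow> (real ^ 'n::finite) set set" where
  "Poly_plus d = {{x. P x \<ge> 0} |P. P \<in> Poly d}"

text \<open>All members of \<open>Poly_plus d\<close> are closed, hence Borel, so their measure is meaningful.\<close>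

lemma closed_Poly_plus: "closed f" if "f \<in> Poly_plus d"
  using that unfolding Poly_plus_def Poly_def monomial_def
  by (auto intro!: closed_Collect_le continuous_intros)

definition is_net :: "real \<Rightarrow> (real ^ 'n::finite) measure \<Rightarrow> (real ^ 'n) set set \<Rightarrow> (real ^ 'n) set \<Rightarrow> bool" where
  "is_net t \<mu> F X \<longleftrightarrow> (\<forall>f\<in>F. measure \<mu> f > t \<longrightarrow> f \<inter> X \<noteq> {})"

end

theory Submission imports Defs
begin

text \<open>If a finite \<open>X\<close> has fewer points than there are monomials of degree at most \<open>D\<close>, linear
  algebra yields a nonzero polynomial \<open>P\<close> of degree at most \<open>D\<close> vanishing on \<open>X\<close>. Its zero set is
  Lebesgue null, so \<open>{x. P x ^ 2 \<ge> \<delta>}\<close> has \<open>\<mu>\<close>-measure tending to \<open>1\<close> as \<open>\<delta> \<rightarrow> 0\<close>, and it misses \<open>X\<close>.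

  Nullity of the zero set is shown by averaging over translates along the curve
  \<open>t \<mapsto> (t ^ k\<^sub>1, \<dots>, t ^ k\<^sub>n)\<close> with \<open>k\<^sub>i\<close> the powers of \<open>D + 1\<close>: along every translate of this curve
  distinct monomials become univariate monic polynomials of distinct degrees, so \<open>P\<close> has only
  finitely many zeros there.\<close>

section \<open>Counting multi-indices\<close>

text \<open>The slack \<open>D - (\<Sum>i. \<alpha> i)\<close> of a multi-index is the multiplicity of an additional element
  \<open>None\<close>, which turns multi-indices into multisets of size exactly \<open>D\<close>.\<close>

lemma binomial_le_card_multiindices:
  "(CARD('n::finite) + D) choose CARD('n) \<le> card (multiindices D :: ('n \<Rightarrow> nat) set)"
proof -
  define A where "A = multisets_of_size (UNIV :: 'n option set) D"
  have size: "size M = count M None + (\<Sum>i\<in>UNIV. count M (Some i))" for M :: "'n option multiset"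
  proof -
    have "size M = (\<Sum>x\<in>UNIV. count M x)"
      unfolding size_multiset_overloaded_eq
      by (rule sum.mono_neutral_left) (auto simp: not_in_iff)
    then show ?thesis
      by (simp add: UNIV_option_conv sum.reindex)
  qed
  have "inj_on (\<lambda>M i. count M (Some i)) A"
  proof (rule inj_onI)
    fix M N assume MN: "M \<in> A" "N \<in> A"
      and eq: "(\<lambda>i. count M (Some i)) = (\<lambda>i. count N (Some i))"
    have "size M = size N" using MN by (simp add: A_def multisets_of_size_def)
    with size[of M] size[of N] fun_cong[OF eq] have "count M None = count N None" by simp
    with fun_cong[OF eq] show "M = N"
      by (intro multiset_eqI) (metis option.exhaust)
  qed
  moreover have "(\<lambda>M i. count M (Some i)) ` A \<subseteq> multiindices D"
    using size by (auto simp: A_def multisets_of_size_def multiindices_def)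
  ultimately have "card A \<le> card (multiindices D :: ('n \<Rightarrow> nat) set)"
    using finite_multiindices card_inj_on_le by blast
  moreover have "card A = (CARD('n) + D) choose CARD('n)"
    using binomial_symmetric[of D "CARD('n) + D"]
    by (simp add: A_def card_multisets_of_size card_UNIV_option)
  ultimately show ?thesis by simp
qed

section \<open>Homogeneous linear systems\<close>

text \<open>Gaussian elimination, by induction on the set of equations \<open>X\<close>: a pivot
  \<open>b\<close> with \<open>g b x \<noteq> 0\<close> makes all the other functions vanish at
  \<open>x\<close>, at the cost of one equation and one unknown.\<close>

lemma underdetermined_linear_system:
  fixes g :: "'i \<Rightarrow> 'x \<Rightarrow> 'a::field"
  assumes "finite X" "finite I" "card X < card I"
  shows "\<exists>c. (\<exists>i\<in>I. c i \<noteq> 0) \<and> (\<forall>x\<in>X. (\<Sum>i\<in>I. c i * g i x) = 0)"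
  using assms
proof (induction X arbitrary: I g rule: finite_induct)
  case empty
  then obtain i where "i \<in> I" by fastforce
  then show ?case by (intro exI[of _ "\<lambda>_. 1"]) auto
next
  case (insert x X)
  show ?case
  proof (cases "\<forall>i\<in>I. g i x = 0")
    case True
    obtain c where "\<exists>i\<in>I. c i \<noteq> 0" "\<forall>x\<in>X. (\<Sum>i\<in>I. c i * g i x) = 0"
      using insert.IH[of I g] insert.prems insert.hyps by auto
    with True show ?thesis by (intro exI[of _ c]) auto
  next
    case False
    then obtain b where b: "b \<in> I" "g b x \<noteq> 0" by blast
    define J where "J = I - {b}"
    have J: "finite J" "b \<notin> J" "I = insert b J" "card X < card J"
      using insert b by (auto simp: J_def)
    obtain c where c: "\<exists>i\<in>J. c i \<noteq> 0"
      "\<And>y. y \<in> X \<Longrightarrow> (\<Sum>i\<in>J. c i * (g i y - g i x / g b x * g b y)) = 0"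
      using insert.IH[OF J(1,4), of "\<lambda>i y. g i y - g i x / g b x * g b y"] by auto
    \<comment> \<open>The coefficient at \<open>b\<close> collects the multiples of
      \<open>g b\<close> that elimination subtracted, so that \<open>d\<close> gives in terms of
      \<open>g\<close> the same combination as \<open>c\<close> gives in terms of the eliminated
      functions.\<close>
    define d where "d = c(b := - (\<Sum>i\<in>J. c i * (g i x / g b x)))"
    have d: "d i = c i" if "i \<in> J" for i
      using that J by (auto simp: d_def)
    have sum: "(\<Sum>i\<in>I. d i * g i y) = (\<Sum>i\<in>J. c i * (g i y - g i x / g b x * g b y))" for y
    proof -
      have "(\<Sum>i\<in>I. d i * g i y) = d b * g b y + (\<Sum>i\<in>J. c i * g i y)"
        using J d by simp
      also have "\<dots> = (\<Sum>i\<in>J. c i * (g i y - g i x / g b x * g b y))"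
        by (simp add: d_def right_diff_distrib sum_subtractf sum_distrib_right mult.assoc)
      finally show ?thesis .
    qed
    \<comment> \<open>At the new point \<open>x\<close> every eliminated function vanishes; at
      points of \<open>X\<close> the induction hypothesis applies.\<close>
    have "(\<Sum>i\<in>I. d i * g i y) = 0" if "y \<in> insert x X" for y
      using that b c(2) by (auto simp: sum)
    moreover have "\<exists>i\<in>I. d i \<noteq> 0"
      using c(1) d J by auto
    ultimately show ?thesis by blast
  qed
qed

section \<open>Separating monomials along a curve\<close>

text \<open>Uniqueness of base \<open>b\<close> expansions: reduction modulo \<open>b\<close>
  isolates the lowest digit, and the induction treats the remaining ones.\<close>

lemma sum_digits_inj:
  fixes b :: nat
  assumes "\<And>k. k < m \<Longrightarrow> \<alpha> k < b" "\<And>k. k < m \<Longrightarrow> \<beta> k < b"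
    and "(\<Sum>k<m. \<alpha> k * b ^ k) = (\<Sum>k<m. \<beta> k * b ^ k)" "k < m"
  shows "\<alpha> k = \<beta> k"
  using assms
proof (induction m arbitrary: \<alpha> \<beta> k)
  case (Suc m)
  have split: "(\<Sum>k<Suc m. \<gamma> k * b ^ k) = \<gamma> 0 + b * (\<Sum>k<m. \<gamma> (Suc k) * b ^ k)" for \<gamma>
    by (subst sum.lessThan_Suc_shift) (simp add: sum_distrib_left mult_ac)
  have digits: "\<alpha> 0 < b" "\<beta> 0 < b" using Suc.prems by auto
  have eq: "\<alpha> 0 + b * (\<Sum>k<m. \<alpha> (Suc k) * b ^ k) = \<beta> 0 + b * (\<Sum>k<m. \<beta> (Suc k) * b ^ k)"
    using Suc.prems(3) by (simp only: split)
  have zero: "\<alpha> 0 = \<beta> 0"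
    using arg_cong[OF eq, of "\<lambda>x. x mod b"] digits by simp
  with eq digits have "(\<Sum>k<m. \<alpha> (Suc k) * b ^ k) = (\<Sum>k<m. \<beta> (Suc k) * b ^ k)"
    by simp
  then have "\<alpha> (Suc j) = \<beta> (Suc j)" if "j < m" for j
    using Suc.IH[of "\<lambda>k. \<alpha> (Suc k)" "\<lambda>k. \<beta> (Suc k)" j] Suc.prems that by simp
  with zero Suc.prems(4) show ?case by (cases k) auto
qed simp

text \<open>The entries of a multi-index are at most \<open>D\<close>, hence digits in base
  \<open>D + 1\<close>. With the powers of \<open>D + 1\<close> as weights, the weighted sum is a
  number whose digits are these entries.\<close>

lemma separating_weights:
  obtains k :: "'n::finite \<Rightarrow> nat"
  where "\<And>i. k i > 0" "inj_on (\<lambda>\<alpha>. \<Sum>i\<in>UNIV. \<alpha> i * k i) (multiindices D)"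
proof -
  obtain h :: "'n \<Rightarrow> nat" where h: "bij_betw h UNIV {..<CARD('n)}"
    using ex_bij_betw_finite_nat[of "UNIV :: 'n set"] by (auto simp: atLeast0LessThan)
  define k where "k = (\<lambda>i. (D + 1) ^ h i)"
  have inv: "inv h (h i) = i" for i
    using h by (simp add: bij_betw_def)
  have sum: "(\<Sum>i\<in>UNIV. \<alpha> i * k i) = (\<Sum>j<CARD('n). \<alpha> (inv h j) * (D + 1) ^ j)" for \<alpha>
    by (subst sum.reindex_bij_betw[OF h, symmetric]) (simp add: k_def inv)
  have bound: "\<alpha> i < D + 1" if "\<alpha> \<in> multiindices D" for \<alpha> and i :: 'n
    using member_le_sum[of i UNIV \<alpha>] that by (force simp: multiindices_def)
  have "inj_on (\<lambda>\<alpha>. \<Sum>i\<in>UNIV. \<alpha> i * k i) (multiindices D)"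
  proof (rule inj_onI)
    fix \<alpha> \<beta> :: "'n \<Rightarrow> nat"
    assume ab: "\<alpha> \<in> multiindices D" "\<beta> \<in> multiindices D"
      and eq: "(\<Sum>i\<in>UNIV. \<alpha> i * k i) = (\<Sum>i\<in>UNIV. \<beta> i * k i)"
    have "\<alpha> (inv h j) = \<beta> (inv h j)" if "j < CARD('n)" for j
      using sum_digits_inj[of "CARD('n)" "\<lambda>j. \<alpha> (inv h j)" "D + 1" "\<lambda>j. \<beta> (inv h j)" j]
        bound[OF ab(1)] bound[OF ab(2)] eq that by (simp only: sum)
    moreover have "h i < CARD('n)" for i
      using h by (auto simp: bij_betw_def)
    ultimately show "\<alpha> = \<beta>" by (metis inv ext)
  qed
  then show thesis by (rule that[rotated]) (simp add: k_def)
qed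

text \<open>The highest degree among the terms with nonzero coefficient occurs only once, so its
  leading term cannot cancel.\<close>

lemma sum_monic_distinct_degrees_nonzero:
  fixes p :: "'i \<Rightarrow> 'a::idom poly"
  assumes "finite I" "\<exists>i\<in>I. c i \<noteq> 0"
    and monic: "\<And>i. i \<in> I \<Longrightarrow> lead_coeff (p i) = 1"
    and inj: "inj_on (\<lambda>i. degree (p i)) I"
  shows "(\<Sum>i\<in>I. smult (c i) (p i)) \<noteq> 0"
proof -
  define S where "S = {i \<in> I. c i \<noteq> 0}"
  have "finite S" "S \<noteq> {}" using assms by (auto simp: S_def)
  then have "Max ((\<lambda>i. degree (p i)) ` S) \<in> (\<lambda>i. degree (p i)) ` S"
    by (intro Max_in) auto
  then obtain m where "m \<in> S" and Max: "Max ((\<lambda>i. degree (p i)) ` S) = degree (p m)"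
    by blast
  moreover have "degree (p i) \<le> degree (p m)" if "i \<in> S" for i
    unfolding Max[symmetric] using \<open>finite S\<close> that by (intro Max_ge) auto
  ultimately have m: "m \<in> S" "\<And>i. i \<in> S \<Longrightarrow> degree (p i) \<le> degree (p m)"
    by blast+
  have "c i * coeff (p i) (degree (p m)) = (if i = m then c m else 0)" if "i \<in> I" for i
  proof (cases "c i = 0 \<or> i = m")
    case True
    then show ?thesis using monic m(1) by (auto simp: S_def)
  next
    case False
    then have "degree (p i) < degree (p m)"
      using m that inj by (metis (mono_tags, lifting) S_def inj_onD le_neq_implies_less mem_Collect_eq)
    then show ?thesis using False by (simp add: coeff_eq_0)
  qed
  then have "coeff (\<Sum>i\<in>I. smult (c i) (p i)) (degree (p m)) = (\<Sum>i\<in>I. if i = m then c m else 0)"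
    by (simp add: coeff_sum)
  also have "\<dots> = c m" using m(1) assms(1) by (simp add: S_def)
  also have "\<dots> \<noteq> 0" using m(1) by (simp add: S_def)
  finally show ?thesis by auto
qed

text \<open>On the translated curve, the monomial of \<alpha> is the product of the
  \<open>(x $ i + t ^ k i) ^ \<alpha> i\<close>, a monic polynomial in \<open>t\<close> whose degree
  is the weighted sum. Injectivity of the weights makes these degrees distinct, so the combination
  is a nonzero polynomial.\<close>

lemma finite_zeros_along_curve:
  fixes c :: "('n::finite \<Rightarrow> nat) \<Rightarrow> real"
  assumes c: "\<exists>\<alpha>\<in>multiindices D. c \<alpha> \<noteq> 0"
    and k: "\<And>i. k i > 0" "inj_on (\<lambda>\<alpha>. \<Sum>i\<in>UNIV. \<alpha> i * k i) (multiindices D)"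
  shows "finite {t. (\<Sum>\<alpha>\<in>multiindices D. c \<alpha> * monomial \<alpha> (x + (\<chi> i. t ^ k i))) = 0}"
proof -
  define q where "q = (\<lambda>i. [:x $ i:] + monom 1 (k i))"
  define p where "p = (\<lambda>\<alpha>::'n \<Rightarrow> nat. \<Prod>i\<in>UNIV. q i ^ \<alpha> i)"
  \<comment> \<open>Positivity of \<open>k i\<close> keeps the constant \<open>x $ i\<close> below
    the leading term.\<close>
  have deg_q: "degree (q i) = k i" for i
    using k(1)[of i] by (simp add: q_def degree_add_eq_right degree_monom_eq)
  have lc_q: "lead_coeff (q i) = 1" for i
    using k(1)[of i] by (subst deg_q) (simp add: q_def coeff_pCons split: nat.split)
  have q0: "q i \<noteq> 0" for i using lc_q[of i] by auto
  have "degree (p \<alpha>) = (\<Sum>i\<in>UNIV. \<alpha> i * k i)" for \<alpha>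
    by (simp add: p_def degree_prod_sum_eq degree_power_eq q0 deg_q)
  moreover have "lead_coeff (p \<alpha>) = 1" for \<alpha>
    unfolding p_def lead_coeff_prod lead_coeff_power lc_q by simp
  ultimately have "(\<Sum>\<alpha>\<in>multiindices D. smult (c \<alpha>) (p \<alpha>)) \<noteq> 0" (is "?R \<noteq> 0")
    using c k(2) by (intro sum_monic_distinct_degrees_nonzero finite_multiindices) auto
  then have "finite {t. poly ?R t = 0}" by (rule poly_roots_finite)
  moreover have "poly ?R t = (\<Sum>\<alpha>\<in>multiindices D. c \<alpha> * monomial \<alpha> (x + (\<chi> i. t ^ k i)))" for t
    by (simp add: poly_sum p_def q_def poly_prod monomial_def poly_monom)
  ultimately show ?thesis by simp
qed

section \<open>Zero sets of polynomials are Lebesgue null\<close>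

text \<open>Fubini for \<open>{(t, x). x + \<gamma> t \<in> N}\<close>: the \<open>t\<close>-sections are translates of \<open>N\<close>.\<close>

lemma null_set_if_finite_along_curve:
  fixes N :: "'a::euclidean_space set" and \<gamma> :: "real \<Rightarrow> 'a"
  assumes "closed N" "continuous_on UNIV \<gamma>" and fin: "\<And>x. finite {t. x + \<gamma> t \<in> N}"
  shows "N \<in> null_sets lborel"
proof -
  have N[measurable]: "N \<in> sets borel" using assms(1) by simp
  have "\<gamma> \<in> borel_measurable lborel"
    using borel_measurable_continuous_onI[OF assms(2)] by simp
  then have "(\<lambda>z. snd z + \<gamma> (fst z)) \<in> borel_measurable (lborel \<Otimes>\<^sub>M lborel)"
    by (intro borel_measurable_add measurable_compose[OF measurable_fst])
      (simp_all add: measurable_snd')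
  from measurable_compose[OF this borel_measurable_indicator[OF N]]
  have meas: "(\<lambda>(t, x). indicator N (x + \<gamma> t) :: ennreal) \<in> borel_measurable (lborel \<Otimes>\<^sub>M lborel)"
    by (simp add: case_prod_unfold)
  let ?f = "\<lambda>t x. indicator N (x + \<gamma> t) :: ennreal"
  have translate: "(\<integral>\<^sup>+x. ?f t x \<partial>lborel) = emeasure lborel N" for t
  proof -
    have "emeasure lborel N = (\<integral>\<^sup>+x. indicator N x \<partial>distr lborel borel ((+) (\<gamma> t)))"
      by (simp add: lborel_distr_plus)
    also have "\<dots> = (\<integral>\<^sup>+x. ?f t x \<partial>lborel)"
      by (subst nn_integral_distr) (simp_all add: add.commute)
    finally show ?thesis by simp
  qed
  have curve_null: "(\<integral>\<^sup>+t. ?f t x \<partial>lborel) = 0" for x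
  proof -
    have "(\<integral>\<^sup>+t. ?f t x \<partial>lborel) = (\<integral>\<^sup>+t. indicator {t. x + \<gamma> t \<in> N} t \<partial>lborel)"
      by (intro nn_integral_cong) (simp add: indicator_def)
    also have "\<dots> = emeasure lborel {t. x + \<gamma> t \<in> N}"
      using finite_imp_null_set_lborel[OF fin[of x]] by (intro nn_integral_indicator) auto
    also have "\<dots> = 0" using finite_imp_null_set_lborel[OF fin[of x]] by auto
    finally show ?thesis .
  qed
  have "(\<integral>\<^sup>+t. \<integral>\<^sup>+x. ?f t x \<partial>lborel \<partial>(lborel :: real measure)) = (\<integral>\<^sup>+x. \<integral>\<^sup>+t. ?f t x \<partial>lborel \<partial>lborel)"
    by (rule lborel_pair.Fubini'[OF meas, symmetric])
  \<comment> \<open>The inner integral over \<open>x\<close> does not depend on \<open>t\<close>,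
    and the line over which \<open>t\<close> ranges has infinite measure.\<close>
  then have "emeasure lborel N * \<infinity> = 0" by (simp add: translate curve_null)
  then show ?thesis by (auto simp: null_sets_def ennreal_mult_eq_top_iff)
qed

lemma continuous_on_monomial [continuous_intros]: "continuous_on S (monomial \<alpha>)"
  unfolding monomial_def by (intro continuous_intros)

lemma null_set_zeros_polynomial:
  fixes c :: "('n::finite \<Rightarrow> nat) \<Rightarrow> real"
  assumes "\<exists>\<alpha>\<in>multiindices D. c \<alpha> \<noteq> 0"
  shows "{x. (\<Sum>\<alpha>\<in>multiindices D. c \<alpha> * monomial \<alpha> x) = 0} \<in> null_sets lborel"
proof -
  obtain k :: "'n \<Rightarrow> nat" where k: "\<And>i. k i > 0"
    "inj_on (\<lambda>\<alpha>. \<Sum>i\<in>UNIV. \<alpha> i * k i) (multiindices D)"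
    using separating_weights by blast
  show ?thesis
  proof (rule null_set_if_finite_along_curve)
    show "closed {x. (\<Sum>\<alpha>\<in>multiindices D. c \<alpha> * monomial \<alpha> x) = 0}"
      by (intro closed_Collect_eq continuous_intros)
    show "continuous_on UNIV (\<lambda>t::real. \<chi> i. t ^ k i)"
      by (intro continuous_on_vec_lambda continuous_intros)
  qed (use finite_zeros_along_curve[OF assms k] in simp)
qed

section \<open>Closure properties of \<open>Poly\<close>\<close>

text \<open>Collecting like terms: expanding a product yields the same multi-index several times,
  whereas \<open>Poly\<close> asks for a single coefficient per multi-index.\<close>

lemma Poly_monomial_sumI:
  fixes \<tau> :: "'i \<Rightarrow> 'n::finite \<Rightarrow> nat"
  assumes "finite I" "\<And>i. i \<in> I \<Longrightarrow> \<tau> i \<in> multiindices d"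
  shows "(\<lambda>x. \<Sum>i\<in>I. c i * monomial (\<tau> i) x) \<in> Poly d"
proof -
  define e where "e = (\<lambda>\<alpha>. \<Sum>i\<in>{i \<in> I. \<tau> i = \<alpha>}. c i)"
  have "(\<Sum>i\<in>I. c i * monomial (\<tau> i) x) = (\<Sum>\<alpha>\<in>multiindices d. e \<alpha> * monomial \<alpha> x)" for x
  proof -
    have "(\<Sum>i\<in>I. c i * monomial (\<tau> i) x)
        = (\<Sum>\<alpha>\<in>multiindices d. \<Sum>i\<in>{i \<in> I. \<tau> i = \<alpha>}. c i * monomial (\<tau> i) x)"
      using assms by (intro sum.group[symmetric] finite_multiindices) auto
    also have "\<dots> = (\<Sum>\<alpha>\<in>multiindices d. e \<alpha> * monomial \<alpha> x)"
      by (intro sum.cong) (auto simp: e_def sum_distrib_right)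
    finally show ?thesis .
  qed
  then show ?thesis unfolding Poly_def by blast
qed

lemma monomial_mult: "monomial \<alpha> x * monomial \<beta> x = monomial (\<lambda>i. \<alpha> i + \<beta> i) x"
  by (simp add: monomial_def power_add prod.distrib)

lemma Poly_diff:
  assumes "P \<in> Poly d" "Q \<in> Poly d"
  shows "(\<lambda>x. P x - Q x) \<in> Poly d"
proof -
  obtain a b where "P = (\<lambda>x. \<Sum>\<alpha>\<in>multiindices d. a \<alpha> * monomial \<alpha> x)"
    "Q = (\<lambda>x. \<Sum>\<alpha>\<in>multiindices d. b \<alpha> * monomial \<alpha> x)"
    using assms unfolding Poly_def by blast
  then have "(\<lambda>x. P x - Q x) = (\<lambda>x. \<Sum>\<alpha>\<in>multiindices d. (a \<alpha> - b \<alpha>) * monomial \<alpha> x)"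
    by (simp add: left_diff_distrib sum_subtractf)
  then show ?thesis unfolding Poly_def by (intro CollectI exI)
qed

lemma Poly_const: "(\<lambda>x::real ^ 'n::finite. a) \<in> Poly d"
  using Poly_monomial_sumI[of "{()}" "\<lambda>_ (_::'n). 0" d "\<lambda>_. a"]
  by (simp add: multiindices_def monomial_def)

lemma Poly_mult:
  fixes P Q :: "real ^ 'n::finite \<Rightarrow> real"
  assumes "P \<in> Poly d" "Q \<in> Poly e"
  shows "(\<lambda>x. P x * Q x) \<in> Poly (d + e)"
proof -
  let ?I = "(multiindices d :: ('n \<Rightarrow> nat) set) \<times> (multiindices e :: ('n \<Rightarrow> nat) set)"
  obtain a b where P: "P = (\<lambda>x. \<Sum>\<alpha>\<in>multiindices d. a \<alpha> * monomial \<alpha> x)"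
    and Q: "Q = (\<lambda>x. \<Sum>\<alpha>\<in>multiindices e. b \<alpha> * monomial \<alpha> x)"
    using assms unfolding Poly_def by blast
  have "P x * Q x = (\<Sum>z\<in>?I. a (fst z) * b (snd z) * monomial (\<lambda>i. fst z i + snd z i) x)" for x
    unfolding P Q sum_product sum.cartesian_product
    by (intro sum.cong) (auto simp: monomial_mult[symmetric])
  moreover have "(\<lambda>x. \<Sum>z\<in>?I. a (fst z) * b (snd z) * monomial (\<lambda>i. fst z i + snd z i) x)
      \<in> Poly (d + e)"
    by (intro Poly_monomial_sumI finite_cartesian_product finite_multiindices)
      (auto simp: multiindices_def sum.distrib intro!: add_mono)
  ultimately show ?thesis by presburger
qed

section \<open>Measure of superlevel sets and size of nets\<close>

text \<open>Continuity from below: the superlevel sets increase as the threshold decreases to 0, and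
  their union is the set where \<open>f\<close> is positive.\<close>

lemma (in finite_measure) superlevel_measure_tendsto:
  assumes [measurable]: "f \<in> borel_measurable M"
  shows "(\<lambda>k. measure M {x \<in> space M. f x \<ge> 1 / real (Suc k)})
    \<longlonglongrightarrow> measure M {x \<in> space M. f x > (0::real)}"
proof -
  let ?A = "\<lambda>k. {x \<in> space M. f x \<ge> 1 / real (Suc k)}"
  have "1 / real (Suc l) \<le> 1 / real (Suc k)" if "k \<le> l" for k l
    using that by (simp add: frac_le)
  then have "incseq ?A" by (fastforce simp: incseq_def intro: order_trans)
  moreover have "(\<Union>k. ?A k) = {x \<in> space M. f x > 0}"
  proof (intro equalityI subsetI)
    fix x assume x: "x \<in> {x \<in> space M. f x > 0}"
    then obtain k where "1 / real (Suc k) < f x"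
      using nat_approx_posE by blast
    with x show "x \<in> (\<Union>k. ?A k)" by (auto intro!: exI[of _ k])
  next
    fix x assume "x \<in> (\<Union>k. ?A k)"
    then obtain k where "x \<in> space M" "1 / real (Suc k) \<le> f x" by auto
    moreover have "0 < 1 / real (Suc k)" by simp
    ultimately have "x \<in> space M" "0 < f x" by linarith+
    then show "x \<in> {x \<in> space M. f x > 0}" by simp
  qed
  ultimately show ?thesis
    using finite_Lim_measure_incseq[of ?A] by (simp add: image_subset_iff)
qed

theorem proposition4:
  fixes \<mu> :: "(real ^ 'n::finite) measure"
    and D :: nat and \<epsilon> :: real and X :: "(real ^ 'n) set"
  assumes "D \<ge> 1"
    and "prob_space \<mu>"
    and "sets \<mu> = sets borel"
    and "absolutely_continuous lborel \<mu>"
    and "\<epsilon> > 0"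
    and "is_net (1 - \<epsilon>) \<mu> (Poly_plus (2 * D)) X"
  shows "infinite X \<or> card X \<ge> (CARD('n) + D) choose CARD('n)"
proof (rule ccontr)
  assume "\<not> ?thesis"
  then have "finite X" "card X < card (multiindices D :: ('n \<Rightarrow> nat) set)"
    using binomial_le_card_multiindices[of D, where 'n = 'n] by auto
  \<comment> \<open>Each point of \<open>X\<close> imposes one linear equation on the coefficients,
    and there are more coefficients than points.\<close>
  then obtain c :: "('n \<Rightarrow> nat) \<Rightarrow> real" where c: "\<exists>\<alpha>\<in>multiindices D. c \<alpha> \<noteq> 0"
    and zero: "\<forall>x\<in>X. (\<Sum>\<alpha>\<in>multiindices D. c \<alpha> * monomial \<alpha> x) = 0"
    using underdetermined_linear_system[OF _ finite_multiindices, of X D monomial] by auto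
  define P where "P = (\<lambda>x. \<Sum>\<alpha>\<in>multiindices D. c \<alpha> * monomial \<alpha> x)"
  have P: "P \<in> Poly D" unfolding Poly_def P_def by blast
  interpret prob_space \<mu> by fact
  have space: "space \<mu> = UNIV"
    using sets_eq_imp_space_eq[OF assms(3)] by simp
  have null: "{x. P x = 0} \<in> null_sets \<mu>"
    using null_set_zeros_polynomial[OF c] assms(4)
    unfolding absolutely_continuous_def P_def by blast
  have "continuous_on UNIV P"
    unfolding P_def by (intro continuous_intros)
  then have meas: "(\<lambda>x. P x * P x) \<in> borel_measurable \<mu>"
    unfolding measurable_cong_sets[OF assms(3) refl]
    by (intro borel_measurable_times borel_measurable_continuous_onI)
  \<comment> \<open>The square is positive exactly off the zero set of \<open>P\<close>, which is
    null for \<mu> by absolute continuity.\<close>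
  have "measure \<mu> {x. P x * P x > 0} = 1"
  proof -
    have "{x. P x * P x > 0} = space \<mu> - {x. P x = 0}"
      by (auto simp: space zero_less_mult_iff)
    then show ?thesis
      using null prob_compl[of "{x. P x = 0}"] measure_eq_0_null_sets[OF null]
      by (simp add: null_setsD2)
  qed
  then have "(\<lambda>k. measure \<mu> {x. P x * P x \<ge> 1 / real (Suc k)}) \<longlonglongrightarrow> 1"
    using superlevel_measure_tendsto[OF meas] by (simp add: space)
  from order_tendstoD(1)[OF this, of "1 - \<epsilon>"]
  have "\<forall>\<^sub>F k in sequentially. measure \<mu> {x. P x * P x \<ge> 1 / real (Suc k)} > 1 - \<epsilon>"
    using \<open>\<epsilon> > 0\<close> by simp
  then obtain k where k: "measure \<mu> {x. P x * P x \<ge> 1 / real (Suc k)} > 1 - \<epsilon>"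
    by (auto dest: eventually_happens)
  \<comment> \<open>Subtracting the threshold turns the set into a superlevel set at 0; squaring
    accounts for the degree \<open>2 * D\<close>.\<close>
  have "(\<lambda>x. P x * P x - 1 / real (Suc k)) \<in> Poly (2 * D)"
    using Poly_diff[OF Poly_mult[OF P P] Poly_const] by (simp add: mult_2)
  moreover have "{x. P x * P x \<ge> 1 / real (Suc k)} = {x. P x * P x - 1 / real (Suc k) \<ge> 0}"
    by auto
  ultimately have "{x. P x * P x \<ge> 1 / real (Suc k)} \<in> Poly_plus (2 * D)"
    unfolding Poly_plus_def by (intro CollectI exI conjI)
  with k assms(6) have "{x. P x * P x \<ge> 1 / real (Suc k)} \<inter> X \<noteq> {}"
    unfolding is_net_def by blast
  \<comment> \<open>The net would have to contain a point where the square of \<open>P\<close> is at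
    least a positive threshold, but \<open>P\<close> vanishes on \<open>X\<close>.\<close>
  then obtain x where "x \<in> X" "P x * P x \<ge> 1 / real (Suc k)" by auto
  moreover have "1 / real (Suc k) > 0" by simp
  ultimately show False using zero by (simp add: P_def)
qed

end
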